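(* Let $k\ge 1$, $m\ge 0$ and $n\ge 1-k$ be integers. Let $\bar c_{k,n,o}^{(m)}$ (respectively $\bar c_{k,n,e}^{(m)}$) be the number of odd (respectively even) compositions of $n+k-1$ with exactly $m$ parts less than $k$, and let $\bar b_{k,n}^{(m)}:=\bar c_{k,n,o}^{(m)}-\bar c_{k,n,e}^{(m)}$. Then \[ \bar b_{k,n}^{(m)}=\sum_{i+j+(k-1)(\ell+i-m-1)=n}(-1)^{i+\ell+1}\binom{i+j-1}{j}\binom{i}{m}\binom{m}{\ell}, \] where the sum is over all nonnegative integers $i,j,\ell$ with $i\ge m$, $\ell\le m$ satisfying $i+j+(k-1)(\ell+i-m-1)=n$.
   Context: A composition of a nonnegative integer $N$ is a finite sequence $\alpha=(\alpha_1,\ldots,\alpha_\ell)$ of positive integers with $\alpha_1+\cdots+\alpha_\ell=N$; the $\alpha_i$ are its parts and $\ell$ is its length (the only composition of $0$ is the empty one, of length $0$). A composition is called even (respectively odd) if its length is even (respectively odd). Binomial coefficients $\binom{a}{b}$ with $a\ge 0$ and $b>a$ are $0$, and $\binom{-1}{0}=1$ (so $\binom{i+j-1}{j}$ is the coefficient of $x^j$ in $(1-x)^{-i}$). *)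

theory Defs
  imports Complex_Main
begin

definition compositions :: "nat \<Rightarrow> nat list set" where
  "compositions N = {a. (\<forall>x\<in>set a. 0 < x) \<and> sum_list a = N}"

definition small_parts :: "nat \<Rightarrow> nat list \<Rightarrow> nat" where
  "small_parts k a = length (filter (\<lambda>x. x < k) a)"

text \<open>The conversion to naturals below only loses information when \<open>n < 1 - k\<close>, a range that is
  excluded wherever these counts are used.\<close>

definition c_odd :: "nat \<Rightarrow> int \<Rightarrow> nat \<Rightarrow> nat" where
  "c_odd k n m =
     card {a \<in> compositions (nat (n + int k - 1)). odd (length a) \<and> small_parts k a = m}"

definition c_even :: "nat \<Rightarrow> int \<Rightarrow> nat \<Rightarrow> nat" where
  "c_even k n m =
     card {a \<in> compositions (nat (n + int k - 1)). even (length a) \<and> small_parts k a = m}"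

definition b_bar :: "nat \<Rightarrow> int \<Rightarrow> nat \<Rightarrow> int" where
  "b_bar k n m = int (c_odd k n m) - int (c_even k n m)"

definition index_set :: "nat \<Rightarrow> int \<Rightarrow> nat \<Rightarrow> (nat \<times> nat \<times> nat) set" where
  "index_set k n m = {(i, j, l). m \<le> i \<and> l \<le> m \<and>
     int i + int j + (int k - 1) * (int l + int i - int m - 1) = n}"

text \<open>The cardinalities and the sum over \<open>index_set\<close> are over finite sets.\<close>

lemma finite_compositions: "finite (compositions N)"
proof (rule finite_subset)
  show "compositions N \<subseteq> {a. set a \<subseteq> {..N} \<and> length a \<le> N}"
  proof
    fix a assume "a \<in> compositions N"
    then have pos: "\<forall>x\<in>set a. 0 < x" and s: "sum_list a = N"
      by (auto simp: compositions_def)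
    from pos have "length a \<le> sum_list a"
      by (induction a) auto
    moreover have "\<forall>x\<in>set a. x \<le> sum_list a"
      using member_le_sum_list by blast
    ultimately show "a \<in> {a. set a \<subseteq> {..N} \<and> length a \<le> N}"
      using s by auto
  qed
  show "finite {a. set a \<subseteq> {..N} \<and> length a \<le> N}"
    by (rule finite_lists_length_le) simp
qed

lemma finite_index_set:
  assumes "k \<ge> 1"
  shows "finite (index_set k n m)"
proof (rule finite_subset)
  let ?B = "{..nat (n + int k - 1)}"
  show "index_set k n m \<subseteq> ?B \<times> ?B \<times> {..m}"
  proof
    fix t assume "t \<in> index_set k n m"
    then obtain i j l where t: "t = (i, j, l)" and mi: "m \<le> i" and lm: "l \<le> m"
      and eq: "int i + int j + (int k - 1) * (int l + int i - int m - 1) = n"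
      by (auto simp: index_set_def)
    have "0 \<le> (int k - 1) * (int l + int i - int m)"
      using assms mi by simp
    moreover have "(int k - 1) * (int l + int i - int m - 1) =
        (int k - 1) * (int l + int i - int m) - (int k - 1)"
      by (simp add: algebra_simps)
    ultimately have "int i + int j \<le> n + int k - 1"
      using eq by linarith
    then show "t \<in> ?B \<times> ?B \<times> {..m}"
      using t lm by auto
  qed
qed auto

text \<open>The natural subtraction in \<open>(i + j - 1) choose j\<close> truncates only for \<open>i = j = 0\<close>, where the
  value \<open>1\<close> is that of the convention for \<open>-1\<close> over \<open>0\<close>.\<close>

lemma choose_eq_gchoose:
  "real ((i + j - 1) choose j) = (real i + real j - 1) gchoose j"
proof (cases "i + j = 0")
  case False
  then have "real i + real j - 1 = real (i + j - 1)"
    by linarith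
  then show ?thesis
    by (simp only: binomial_gbinomial)
qed simp

end

theory Submission
  imports Defs "HOL-Computational_Algebra.Formal_Power_Series"
begin

text \<open>The identity holds length by length. Let \<open>S = x + \<dots> + x\<^sup>k\<^sup>-\<^sup>1\<close> and
  \<open>L = x\<^sup>k + x\<^sup>k\<^sup>+\<^sup>1 + \<dots>\<close> be the generating functions of the small and of the large parts.
  Compositions with \<open>i\<close> parts, \<open>m\<close> of them small, have generating function
  \<open>(i choose m) S\<^sup>m L\<^sup>i\<^sup>-\<^sup>m\<close>. Since \<open>S = x (1 - x\<^sup>k\<^sup>-\<^sup>1) / (1 - x)\<close> and \<open>L = x\<^sup>k / (1 - x)\<close>,
  expanding \<open>(1 - x\<^sup>k\<^sup>-\<^sup>1)\<^sup>m\<close> and \<open>(1 - x)\<^sup>-\<^sup>i\<close> gives the terms of the right-hand side with that \<open>i\<close>.\<close>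

definition compositions_of_length :: "nat \<Rightarrow> nat \<Rightarrow> nat \<Rightarrow> nat \<Rightarrow> nat list set" where
  "compositions_of_length k i m N = {a \<in> compositions N. length a = i \<and> small_parts k a = m}"

definition length_fps :: "nat \<Rightarrow> nat \<Rightarrow> nat \<Rightarrow> int fps" where
  "length_fps k i m = Abs_fps (\<lambda>N. int (card (compositions_of_length k i m N)))"

definition small_fps :: "nat \<Rightarrow> int fps" where
  "small_fps k = Abs_fps (\<lambda>x. of_bool (0 < x \<and> x < k))"

definition large_fps :: "nat \<Rightarrow> int fps" where
  "large_fps k = Abs_fps (\<lambda>x. of_bool (0 < x \<and> k \<le> x))"

definition geometric_fps :: "int fps" where
  "geometric_fps = Abs_fps (\<lambda>_. 1)"

lemma finite_compositions_of_length: "finite (compositions_of_length k i m N)"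
  by (simp add: compositions_of_length_def finite_compositions)

lemma length_le_sum_list:
  fixes a :: "nat list"
  assumes "\<forall>x\<in>set a. 0 < x"
  shows "length a \<le> sum_list a"
  using assms by (induction a) auto

text \<open>Split off the first part \<open>x\<close>: a small one uses up one of the
  \<open>m\<close> small parts, a large one leaves \<open>m\<close> unchanged. The case
  \<open>m = 0\<close> is separate because \<open>m - 1\<close> truncates there.\<close>

lemma card_compositions_of_length_Suc:
  "card (compositions_of_length k (Suc i) m N) =
    (\<Sum>x\<le>N. if 0 < x then
       (if x < k then (if m = 0 then 0 else card (compositions_of_length k i (m - 1) (N - x)))
        else card (compositions_of_length k i m (N - x))) else 0)"
proof -
  define P where "P x = {a. x # a \<in> compositions_of_length k (Suc i) m N}" for x
  have "compositions_of_length k (Suc i) m N = (\<Union>x\<le>N. Cons x ` P x)"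
    by (auto simp: P_def compositions_of_length_def compositions_def length_Suc_conv image_iff)
  moreover have "finite (Cons x ` P x)" for x
    by (rule finite_subset[OF _ finite_compositions_of_length[of k "Suc i" m N]])
      (auto simp: P_def)
  ultimately have "card (compositions_of_length k (Suc i) m N) = (\<Sum>x\<le>N. card (Cons x ` P x))"
    by (simp only:) (rule card_UN_disjoint; auto)
  also have "\<dots> = (\<Sum>x\<le>N. card (P x))"
    by (simp add: card_image)
  also have "P x = (if 0 < x then
       (if x < k then (if m = 0 then {} else compositions_of_length k i (m - 1) (N - x))
        else compositions_of_length k i m (N - x)) else {})" if "x \<le> N" for x
    using that by (auto simp: P_def compositions_of_length_def compositions_def small_parts_def)
  then have "(\<Sum>x\<le>N. card (P x)) = (\<Sum>x\<le>N. if 0 < x then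
       (if x < k then (if m = 0 then 0 else card (compositions_of_length k i (m - 1) (N - x)))
        else card (compositions_of_length k i m (N - x))) else 0)"
    by (intro sum.cong) auto
  finally show ?thesis .
qed

text \<open>The recursion on the first part is a convolution, that is, a product of power
  series.\<close>

lemma length_fps_Suc:
  "length_fps k (Suc i) m =
    (if m = 0 then 0 else small_fps k * length_fps k i (m - 1)) + large_fps k * length_fps k i m"
proof (rule fps_ext)
  fix N
  show "fps_nth (length_fps k (Suc i) m) N = fps_nth ((if m = 0 then 0
    else small_fps k * length_fps k i (m - 1)) + large_fps k * length_fps k i m) N"
    unfolding length_fps_def small_fps_def large_fps_def
    by (cases "m = 0")
      (simp_all add: card_compositions_of_length_Suc fps_mult_nth atLeast0AtMost
        sum.distrib[symmetric] if_distrib cong: if_cong del: sum_of_bool_mult_eq,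
        auto intro!: sum.cong simp del: sum_of_bool_mult_eq)
qed

lemma length_fps_0: "length_fps k 0 m = of_bool (m = 0)"
proof -
  have "compositions_of_length k 0 m N = (if m = 0 \<and> N = 0 then {[]} else {})" for N
    by (auto simp: compositions_of_length_def compositions_def small_parts_def)
  then show ?thesis
    by (intro fps_ext) (simp add: length_fps_def)
qed

text \<open>Induction on \<open>i\<close> with Pascal's rule. For \<open>m > i\<close> the exponent
  \<open>i - m\<close> truncates, but the binomial coefficient is then 0.\<close>

lemma length_fps_eq:
  "length_fps k i m = of_nat (i choose m) * small_fps k ^ m * large_fps k ^ (i - m)"
proof (induction i arbitrary: m)
  case 0
  show ?case by (cases m) (simp_all add: length_fps_0)
next
  case (Suc i)
  show ?case
  proof (cases m)
    case 0
    then show ?thesis by (simp add: length_fps_Suc Suc.IH)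
  next
    case m: (Suc p)
    show ?thesis
    \<comment> \<open>If \<open>p < i\<close>, both terms of the recursion carry the power
      \<open>i - p\<close> of \<open>large_fps k\<close>. Otherwise \<open>i choose Suc p\<close> is
      0 and only the term with a small first part can survive.\<close>
    proof (cases "p < i")
      case True
      then have "i - p = Suc (i - Suc p)" by simp
      then show ?thesis by (simp add: m length_fps_Suc Suc.IH algebra_simps)
    next
      case False
      then show ?thesis by (simp add: m length_fps_Suc Suc.IH algebra_simps)
    qed
  qed
qed

text \<open>The finite sum is the difference of the tails of the geometric series that start at
  exponents 1 and \<open>k\<close>.\<close>

lemma small_fps_eq:
  assumes "k \<ge> 1"
  shows "small_fps k = fps_X * (1 - fps_X ^ (k - 1)) * geometric_fps"
proof -
  have "small_fps k = geometric_fps * fps_X ^ 1 - geometric_fps * fps_X ^ k"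
    using assms
    by (intro fps_ext) (auto simp: small_fps_def geometric_fps_def fps_X_power_mult_right_nth)
  moreover have "fps_X ^ k = (fps_X * fps_X ^ (k - 1) :: int fps)"
    using assms by (cases k) auto
  ultimately show ?thesis by (simp add: algebra_simps)
qed

lemma large_fps_eq:
  assumes "k \<ge> 1"
  shows "large_fps k = fps_X ^ k * geometric_fps"
  using assms
  by (intro fps_ext) (auto simp: large_fps_def geometric_fps_def fps_X_power_mult_nth)

text \<open>Multiplication by the geometric series takes partial sums of coefficients, so the
  induction step is the hockey-stick identity.\<close>

lemma geometric_fps_power_nth:
  "fps_nth (geometric_fps ^ i) j = int ((i + j - 1) choose j)"
proof (induction i arbitrary: j)
  case 0
  show ?case by (cases j) auto
next
  case (Suc i)
  have "fps_nth geometric_fps t = 1" for t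
    by (simp add: geometric_fps_def)
  then have "fps_nth (geometric_fps ^ Suc i) j = int (\<Sum>t\<le>j. (i + t - 1) choose t)"
    by (simp add: power_Suc2 fps_mult_nth Suc.IH atLeast0AtMost del: power_Suc)
  also have "(\<Sum>t\<le>j. (i + t - 1) choose t) = (i + j) choose j"
  \<comment> \<open>For \<open>i = 0\<close> the subtraction truncates at \<open>t = 0\<close>,
    where the summand is 1; all other summands are 0. For \<open>i = Suc r\<close> the summands are
    \<open>(r + t) choose t\<close>.\<close>
  proof (cases i)
    case 0
    then have "(\<Sum>t\<le>j. (i + t - 1) choose t) = (\<Sum>t\<le>j. of_bool (t = 0))"
      by (intro sum.cong) auto
    with 0 show ?thesis by simp
  next
    case (Suc r)
    then show ?thesis using sum_choose_lower[of r j] by simp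
  qed
  finally show ?case by simp
qed

text \<open>Here \<open>l\<close> indexes the binomial expansion of the \<open>m\<close>-th power of
  \<open>1 - fps_X ^ (k - 1)\<close>. The condition says that the power of \<open>fps_X\<close> in
  the \<open>l\<close>-th term does not exceed \<open>N\<close>; what remains of \<open>N\<close> is
  the index of the coefficient taken from \<open>geometric_fps ^ i\<close>.\<close>

lemma card_compositions_of_length:
  assumes "k \<ge> 1" and "m \<le> i"
  shows "int (card (compositions_of_length k i m N)) =
    (\<Sum>l\<le>m. if i + (k - 1) * (l + (i - m)) \<le> N
       then (-1) ^ l * int ((i + (N - (i + (k - 1) * (l + (i - m)))) - 1) choose
              (N - (i + (k - 1) * (l + (i - m))))) * int (i choose m) * int (m choose l)
       else 0)"
proof -
  \<comment> \<open>Each small part contributes a factor \<open>fps_X\<close>, each large part a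
    factor \<open>fps_X ^ k\<close>.\<close>
  have "k * (i - m) + m = i + (k - 1) * (i - m)"
    using assms by (cases k) auto
  then have X: "fps_X ^ m * fps_X ^ (k * (i - m)) =
      (fps_X ^ (i + (k - 1) * (i - m)) :: int fps)"
    by (metis add.commute power_add)
  have G: "geometric_fps ^ m * geometric_fps ^ (i - m) = geometric_fps ^ i"
    using assms by (simp flip: power_add)
  have "(1 - fps_X ^ (k - 1)) ^ m =
      (\<Sum>l\<le>m. of_nat (m choose l) * (- (fps_X ^ (k - 1))) ^ l :: int fps)"
    using binomial_ring[of "- (fps_X ^ (k - 1)) :: int fps" 1 m] by simp
  also have "\<dots> = (\<Sum>l\<le>m. fps_const ((-1) ^ l * int (m choose l)) * fps_X ^ ((k - 1) * l))"
    by (intro sum.cong refl, subst power_minus)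
      (simp add: power_mult[symmetric] fps_of_nat[symmetric] fps_const_mult[symmetric]
        fps_const_power[symmetric] fps_const_neg[symmetric] mult_ac del: fps_const_mult
        fps_const_power fps_const_neg)
  finally have B: "(1 - fps_X ^ (k - 1)) ^ m =
      (\<Sum>l\<le>m. fps_const ((-1) ^ l * int (m choose l)) * fps_X ^ ((k - 1) * l))" .
  have "length_fps k i m = of_nat (i choose m) * (1 - fps_X ^ (k - 1)) ^ m *
      (fps_X ^ m * fps_X ^ (k * (i - m))) * (geometric_fps ^ m * geometric_fps ^ (i - m))"
    using assms
    by (simp add: length_fps_eq small_fps_eq large_fps_eq power_mult_distrib power_mult mult_ac)
  also have "\<dots> = (\<Sum>l\<le>m. fps_const ((-1) ^ l * int (i choose m) * int (m choose l)) *
      (fps_X ^ (i + (k - 1) * (l + (i - m))) * geometric_fps ^ i))"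
    unfolding X G B sum_distrib_left sum_distrib_right
    by (intro sum.cong refl)
      (simp add: power_add distrib_left fps_of_nat[symmetric] fps_const_mult[symmetric] mult_ac
        del: fps_const_mult)
  finally have "fps_nth (length_fps k i m) N = (\<Sum>l\<le>m. fps_nth
      (fps_const ((-1) ^ l * int (i choose m) * int (m choose l)) *
      (fps_X ^ (i + (k - 1) * (l + (i - m))) * geometric_fps ^ i)) N)"
    by (simp add: fps_sum_nth)
  then show ?thesis
    unfolding length_fps_def fps_nth_Abs_fps fps_mult_left_const_nth fps_X_power_mult_nth
      geometric_fps_power_nth
    by (auto intro!: sum.cong)
qed

text \<open>Parts are positive, so lengths are at most \<open>N\<close>, and the sign
  \<open>(-1) ^ (i + 1)\<close> counts odd lengths positively and even ones negatively.\<close>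

lemma b_bar_eq_sum_length:
  fixes k m :: nat and n :: int
  defines "N \<equiv> nat (n + int k - 1)"
  shows "b_bar k n m =
    (\<Sum>i\<le>N. (-1) ^ (i + 1) * int (card (compositions_of_length k i m N)))"
proof -
  have le: "length a \<le> N" if "a \<in> compositions N" for a
    using that length_le_sum_list by (auto simp: compositions_def)
  \<comment> \<open>The predicate \<open>Q\<close> stands for either parity.\<close>
  have *: "card {a \<in> compositions N. Q (length a) \<and> small_parts k a = m} =
      (\<Sum>i\<le>N. of_bool (Q i) * card (compositions_of_length k i m N))" for Q
  proof -
    have "{a \<in> compositions N. Q (length a) \<and> small_parts k a = m} =
        (\<Union>i\<in>{i. i \<le> N \<and> Q i}. compositions_of_length k i m N)"
      using le by (auto simp: compositions_of_length_def)
    also have "card \<dots> = (\<Sum>i\<in>{i. i \<le> N \<and> Q i}. card (compositions_of_length k i m N))"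
      by (rule card_UN_disjoint)
        (auto simp: finite_compositions_of_length, auto simp: compositions_of_length_def)
    also have "\<dots> = (\<Sum>i\<le>N. of_bool (Q i) * card (compositions_of_length k i m N))"
      by (intro sum.mono_neutral_cong_left) auto
    finally show ?thesis .
  qed
  show ?thesis
    unfolding b_bar_def c_odd_def c_even_def N_def[symmetric] *[of even] *[of odd]
      of_nat_sum sum_subtractf[symmetric]
    by (intro sum.cong) auto
qed

text \<open>Adding \<open>k - 1\<close> to both sides of the integer equation absorbs the
  \<open>- 1\<close> in its last factor. All terms are then natural numbers, and the bound on
  \<open>n\<close> makes the conversion in \<open>N\<close> exact.\<close>

lemma index_set_eq:
  fixes k m :: nat and n :: int
  assumes "k \<ge> 1" and "n \<ge> 1 - int k"
  defines "N \<equiv> nat (n + int k - 1)"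
  shows "(i, j, l) \<in> index_set k n m \<longleftrightarrow>
    m \<le> i \<and> l \<le> m \<and> i + j + (k - 1) * (l + (i - m)) = N"
proof (cases "m \<le> i")
  case True
  have "int (i + j + (k - 1) * (l + (i - m))) =
      int i + int j + (int k - 1) * (int l + int i - int m - 1) + (int k - 1)"
    using True assms(1) by (simp add: of_nat_diff) (simp add: algebra_simps)
  moreover have "int N = n + (int k - 1)"
    using assms by simp
  ultimately show ?thesis
    using True unfolding index_set_def of_nat_eq_iff[symmetric, where 'a = int] by auto
qed (simp add: index_set_def)

theorem theorem4p4:
  fixes k m :: nat and n :: int
  assumes "k \<ge> 1" and "n \<ge> 1 - int k"
  shows "b_bar k n m =
    (\<Sum>(i, j, l)\<in>index_set k n m.
       (-1) ^ (i + l + 1) * int ((i + j - 1) choose j) * int (i choose m) * int (m choose l))"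
proof -
  define N where "N = nat (n + int k - 1)"
  define e where "e i l = i + (k - 1) * (l + (i - m))" for i l
  define f where "f = (\<lambda>(i, j, l).
    (-1) ^ (i + l + 1) * int ((i + j - 1) choose j) * int (i choose m) * int (m choose l))"
  have idx: "(i, j, l) \<in> index_set k n m \<longleftrightarrow> m \<le> i \<and> l \<le> m \<and> e i l + j = N" for i j l
    unfolding N_def e_def using index_set_eq[OF assms] by (auto simp: algebra_simps)
  have empty: "compositions_of_length k i m N = {}" if "i < m" for i
    using that
    by (auto simp: compositions_of_length_def small_parts_def)
      (metis length_filter_le linorder_not_le)
  have "b_bar k n m =
      (\<Sum>i\<le>N. (-1) ^ (i + 1) * int (card (compositions_of_length k i m N)))"
    unfolding N_def by (rule b_bar_eq_sum_length)
  also have "\<dots> = (\<Sum>i\<in>{m..N}. (-1) ^ (i + 1) * int (card (compositions_of_length k i m N)))"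
    by (intro sum.mono_neutral_right) (auto simp: empty)
  also have "\<dots> = (\<Sum>i\<in>{m..N}. \<Sum>l\<le>m. if e i l \<le> N then f (i, N - e i l, l) else 0)"
    using assms(1)
    by (intro sum.cong refl)
      (auto simp: card_compositions_of_length sum_distrib_left e_def f_def power_add
        intro!: sum.cong)
  also have "\<dots> = (\<Sum>(i, l)\<in>{m..N} \<times> {..m}. if e i l \<le> N then f (i, N - e i l, l) else 0)"
    by (simp add: sum.cartesian_product)
  \<comment> \<open>The bound \<open>i \<le> N\<close> follows from \<open>e i l \<le> N\<close>,
    since \<open>i \<le> e i l\<close>.\<close>
  also have "\<dots> = (\<Sum>(i, l)\<in>{(i, l). m \<le> i \<and> l \<le> m \<and> e i l \<le> N}. f (i, N - e i l, l))"
    by (intro sum.mono_neutral_cong_right) (auto simp: e_def split: if_splits)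
  \<comment> \<open>In an index triple, \<open>j\<close> is determined by \<open>i\<close> and
    \<open>l\<close> as \<open>N - e i l\<close>, so forgetting \<open>j\<close> is a
    bijection.\<close>
  also have "\<dots> = (\<Sum>t\<in>index_set k n m. f t)"
    by (rule sum.reindex_bij_witness[of _ "\<lambda>(i, j, l). (i, l)" "\<lambda>(i, l). (i, N - e i l, l)"])
      (auto simp: idx)
  finally show ?thesis
    unfolding f_def .
qed

end
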